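(* Using the tableau of named MacMahon cubes described in the context: select a set $P$ of exactly three column letters from $\{a,b,c,d,e,f\}$, and then select four rows such that exactly two of the selected row letters correspond (as uppercase versions) to letters in $P$ and the other two do not. The tableau positions lying in neither a selected row nor a selected column consist of five cubes and one empty diagonal position; call these five cubes the targets. The tableau positions lying in both a selected row and a selected column contain exactly $10$ cubes, exactly two of which are mirror cubes of targets; let $W$ be the remaining $8$ cubes. Then $W$ has positive solution number for each of the five targets. The same conclusion holds for the analogous construction with the roles of rows and columns interchanged (select three row letters, then four columns of which exactly two correspond to selected rows and two do not).
   Context: A MacMahon cube is a cube whose six faces are painted with the colors $1,\dots,6$, each used once, up to rotation (there are $30$ of them). At each vertex three faces meet; reading their colors clockwise as seen from outside gives a cyclic triple, and the corner number of the vertex is the cyclic rotation of this triple of smallest three-digit value; a MacMahon cube is determined by its set of $8$ corner numbers. The $30$ MacMahon cubes are named $Xy$ with row letter $X\in\{A,\dots,F\}$ and column letter $y\in\{a,\dots,f\}$, $y$ not the lowercase of $X$ (the diagonal positions $Aa,Bb,\dots,Ff$ of the $6\times6$ tableau are empty); row $X$ consists of cubes $Xy$, column $y$ of cubes $Xy$; row letter $X$ and column letter $x$ correspond. The mirror cube of $Xy$ is $Yx$. Corner numbers: Ab $\{143,345,235,132,126,256,465,164\}$; Ac $\{153,134,142,125,265,246,364,356\}$; Ad $\{243,123,152,254,456,165,136,346\}$; Ae $\{354,145,124,234,263,162,156,365\}$; Af $\{245,154,135,253,236,163,146,264\}$; Ba $\{123,253,354,134,146,456,265,162\}$; Bc $\{143,154,245,234,263,256,165,136\}$;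 Bd $\{153,132,124,145,465,264,236,356\}$; Be $\{152,135,345,254,246,364,163,126\}$; Bf $\{243,235,125,142,164,156,365,346\}$; Ca $\{152,124,143,135,365,346,264,256\}$; Cb $\{243,254,145,134,163,156,265,236\}$; Cd $\{235,345,154,125,162,146,364,263\}$; Ce $\{245,253,123,142,164,136,356,465\}$; Cf $\{153,354,234,132,126,246,456,165\}$; Da $\{245,125,132,234,364,163,156,465\}$; Db $\{154,142,123,135,365,263,246,456\}$; Dc $\{152,145,354,253,236,346,164,126\}$; De $\{153,235,243,134,146,264,256,165\}$; Df $\{143,124,254,345,356,265,162,136\}$; Ea $\{243,142,154,345,356,165,126,236\}$; Eb $\{245,354,153,125,162,136,346,264\}$; Ec $\{124,132,235,254,456,365,163,146\}$; Ed $\{143,234,253,135,156,265,246,164\}$; Ef $\{152,123,134,145,465,364,263,256\}$; Fa $\{235,153,145,254,246,164,136,263\}$; Fb $\{124,152,253,234,364,356,165,146\}$; Fc $\{123,243,345,135,156,465,264,162\}$; Fd $\{354,245,142,134,163,126,256,365\}$; Fe $\{154,143,132,125,265,236,346,456\}$. For a target MacMahon cube $T$ and a set $W$ of eight distinct MacMahon cubes, a solution is a bijection $\sigma$ from $W$ to the corner numbers of $T$ with $\sigma(C)$ a corner number of $C$ for every $C\in W$ (an arrangement of the cubes into a $2\times2\times2$ block whose exterior is colored like an enlarged $T$, no condition on interior faces); the solution number is the number of solutions. *)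

theory Defs
  imports Main "HOL-Library.FuncSet"
begin

datatype face = Up | Down | Right | Left | Front | Back

definition colouring :: "(face \<Rightarrow> nat) \<Rightarrow> bool" where
  "colouring c \<longleftrightarrow> bij_betw c UNIV {1..6}"

definition corner_number :: "nat \<Rightarrow> nat \<Rightarrow> nat \<Rightarrow> nat" where
  "corner_number i j k =
     min (100 * i + 10 * j + k) (min (100 * j + 10 * k + i) (100 * k + 10 * i + j))"

text \<open>Each triple lists the faces at a vertex clockwise as seen from outside.\<close>

definition colouring_corners :: "(face \<Rightarrow> nat) \<Rightarrow> nat set" where
  "colouring_corners c = (\<lambda>(p, q, r). corner_number (c p) (c q) (c r)) `
     {(Up, Right, Front), (Up, Front, Left), (Up, Left, Back), (Up, Back, Right),
      (Down, Front, Right), (Down, Left, Front), (Down, Back, Left), (Down, Right, Back)}"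

text \<open>The same six letters label the rows and the columns of the tableau, so the row letter
  \<open>X\<close> and the corresponding column letter \<open>x\<close> are the same element. The pair \<open>(X, y)\<close> is a
  tableau position; off the diagonal it is the name of a MacMahon cube, and a cube is
  represented by its name. The lemmas after the table justify this: the corner numbers
  come from a colouring, and distinct names have distinct corner numbers.\<close>

datatype letter = LA | LB | LC | LD | LE | LF

type_synonym position = "letter \<times> letter"

definition cubes :: "position set" where
  "cubes = {(X, y). X \<noteq> y}"

definition mirror :: "position \<Rightarrow> position" where
  "mirror = (\<lambda>(X, y). (y, X))"

fun corner_numbers :: "position \<Rightarrow> nat set" where
  "corner_numbers (LA, LB) = {143, 345, 235, 132, 126, 256, 465, 164}"
| "corner_numbers (LA, LC) = {153, 134, 142, 125, 265, 246, 364, 356}"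
| "corner_numbers (LA, LD) = {243, 123, 152, 254, 456, 165, 136, 346}"
| "corner_numbers (LA, LE) = {354, 145, 124, 234, 263, 162, 156, 365}"
| "corner_numbers (LA, LF) = {245, 154, 135, 253, 236, 163, 146, 264}"
| "corner_numbers (LB, LA) = {123, 253, 354, 134, 146, 456, 265, 162}"
| "corner_numbers (LB, LC) = {143, 154, 245, 234, 263, 256, 165, 136}"
| "corner_numbers (LB, LD) = {153, 132, 124, 145, 465, 264, 236, 356}"
| "corner_numbers (LB, LE) = {152, 135, 345, 254, 246, 364, 163, 126}"
| "corner_numbers (LB, LF) = {243, 235, 125, 142, 164, 156, 365, 346}"
| "corner_numbers (LC, LA) = {152, 124, 143, 135, 365, 346, 264, 256}"
| "corner_numbers (LC, LB) = {243, 254, 145, 134, 163, 156, 265, 236}"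
| "corner_numbers (LC, LD) = {235, 345, 154, 125, 162, 146, 364, 263}"
| "corner_numbers (LC, LE) = {245, 253, 123, 142, 164, 136, 356, 465}"
| "corner_numbers (LC, LF) = {153, 354, 234, 132, 126, 246, 456, 165}"
| "corner_numbers (LD, LA) = {245, 125, 132, 234, 364, 163, 156, 465}"
| "corner_numbers (LD, LB) = {154, 142, 123, 135, 365, 263, 246, 456}"
| "corner_numbers (LD, LC) = {152, 145, 354, 253, 236, 346, 164, 126}"
| "corner_numbers (LD, LE) = {153, 235, 243, 134, 146, 264, 256, 165}"
| "corner_numbers (LD, LF) = {143, 124, 254, 345, 356, 265, 162, 136}"
| "corner_numbers (LE, LA) = {243, 142, 154, 345, 356, 165, 126, 236}"
| "corner_numbers (LE, LB) = {245, 354, 153, 125, 162, 136, 346, 264}"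
| "corner_numbers (LE, LC) = {124, 132, 235, 254, 456, 365, 163, 146}"
| "corner_numbers (LE, LD) = {143, 234, 253, 135, 156, 265, 246, 164}"
| "corner_numbers (LE, LF) = {152, 123, 134, 145, 465, 364, 263, 256}"
| "corner_numbers (LF, LA) = {235, 153, 145, 254, 246, 164, 136, 263}"
| "corner_numbers (LF, LB) = {124, 152, 253, 234, 364, 356, 165, 146}"
| "corner_numbers (LF, LC) = {123, 243, 345, 135, 156, 465, 264, 162}"
| "corner_numbers (LF, LD) = {354, 245, 142, 134, 163, 126, 256, 365}"
| "corner_numbers (LF, LE) = {154, 143, 132, 125, 265, 236, 346, 456}"
| "corner_numbers _ = {}"

lemma cubes_cases:
  assumes "C \<in> cubes"
  obtains "C = (LA, LB)" | "C = (LA, LC)" | "C = (LA, LD)" | "C = (LA, LE)" | "C = (LA, LF)"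
    | "C = (LB, LA)" | "C = (LB, LC)" | "C = (LB, LD)" | "C = (LB, LE)" | "C = (LB, LF)"
    | "C = (LC, LA)" | "C = (LC, LB)" | "C = (LC, LD)" | "C = (LC, LE)" | "C = (LC, LF)"
    | "C = (LD, LA)" | "C = (LD, LB)" | "C = (LD, LC)" | "C = (LD, LE)" | "C = (LD, LF)"
    | "C = (LE, LA)" | "C = (LE, LB)" | "C = (LE, LC)" | "C = (LE, LD)" | "C = (LE, LF)"
    | "C = (LF, LA)" | "C = (LF, LB)" | "C = (LF, LC)" | "C = (LF, LD)" | "C = (LF, LE)"
proof -
  obtain X y where "C = (X, y)" by (cases C)
  with assms show ?thesis
    by (cases X; cases y) (simp_all add: cubes_def, (erule that)+)
qed

definition col_of :: "nat \<Rightarrow> nat \<Rightarrow> nat \<Rightarrow> nat \<Rightarrow> nat \<Rightarrow> nat \<Rightarrow> face \<Rightarrow> nat" where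
  "col_of u d r l f b = case_face u d r l f b"

lemma UNIV_face: "UNIV = {Up, Down, Right, Left, Front, Back}"
  by (auto intro: face.exhaust)

lemma colouring_col_of:
  assumes "{u, d, r, l, f, b} = {1..6}"
  shows "colouring (col_of u d r l f b)"
proof -
  have img: "col_of u d r l f b ` UNIV = {1..6}"
    using assms by (simp add: UNIV_face col_of_def)
  have "card (col_of u d r l f b ` UNIV) = card (UNIV :: face set)"
    unfolding img by (simp add: UNIV_face)
  then have "inj_on (col_of u d r l f b) UNIV"
    by (intro eq_card_imp_inj_on) (simp_all add: UNIV_face)
  with img show ?thesis by (simp add: colouring_def bij_betw_def)
qed

lemma colouring_corners_col_of:
  "colouring_corners (col_of u d r l f b) =
     {corner_number u r f, corner_number u f l, corner_number u l b, corner_number u b r,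
      corner_number d f r, corner_number d l f, corner_number d b l, corner_number d r b}"
  by (simp add: colouring_corners_def col_of_def)

lemma atLeastAtMost_1_6: "{1..6} = {1, 2, 3, 4, 5, 6 :: nat}"
  by auto

lemma corner_numbers_colouring:
  assumes "C \<in> cubes"
  shows "\<exists>c. colouring c \<and> corner_numbers C = colouring_corners c"
proof -
  have witness: ?thesis if "{u, d, r, l, f, b} = {1..6}"
    and "corner_numbers C = colouring_corners (col_of u d r l f b)" for u d r l f b
    using that colouring_col_of by blast
  note defs = atLeastAtMost_1_6 colouring_corners_col_of corner_number_def
  from assms show ?thesis
  proof (cases rule: cubes_cases)
    case 1
    show ?thesis by (rule witness[of 1 5 2 4 6 3]) (unfold 1 defs set_eq_subset, simp_all)
  next
    case 2
    show ?thesis by (rule witness[of 1 6 2 3 5 4]) (unfold 2 defs set_eq_subset, simp_all)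
  next
    case 3
    show ?thesis by (rule witness[of 1 4 2 6 3 5]) (unfold 3 defs set_eq_subset, simp_all)
  next
    case 4
    show ?thesis by (rule witness[of 1 3 2 5 4 6]) (unfold 4 defs set_eq_subset, simp_all)
  next
    case 5
    show ?thesis by (rule witness[of 1 2 3 4 5 6]) (unfold 5 defs set_eq_subset, simp_all)
  next
    case 6
    show ?thesis by (rule witness[of 1 5 2 4 3 6]) (unfold 6 defs set_eq_subset, simp_all)
  next
    case 7
    show ?thesis by (rule witness[of 1 2 3 5 6 4]) (unfold 7 defs set_eq_subset, simp_all)
  next
    case 8
    show ?thesis by (rule witness[of 1 6 2 5 4 3]) (unfold 8 defs set_eq_subset, simp_all)
  next
    case 9
    show ?thesis by (rule witness[of 1 4 2 3 6 5]) (unfold 9 defs set_eq_subset, simp_all)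
  next
    case 10
    show ?thesis by (rule witness[of 1 3 2 6 5 4]) (unfold 10 defs set_eq_subset, simp_all)
  next
    case 11
    show ?thesis by (rule witness[of 1 6 2 3 4 5]) (unfold 11 defs set_eq_subset, simp_all)
  next
    case 12
    show ?thesis by (rule witness[of 1 2 3 5 4 6]) (unfold 12 defs set_eq_subset, simp_all)
  next
    case 13
    show ?thesis by (rule witness[of 1 3 2 4 5 6]) (unfold 13 defs set_eq_subset, simp_all)
  next
    case 14
    show ?thesis by (rule witness[of 1 5 2 6 3 4]) (unfold 14 defs set_eq_subset, simp_all)
  next
    case 15
    show ?thesis by (rule witness[of 1 4 2 5 6 3]) (unfold 15 defs set_eq_subset, simp_all)
  next
    case 16
    show ?thesis by (rule witness[of 1 4 2 6 5 3]) (unfold 16 defs set_eq_subset, simp_all)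
  next
    case 17
    show ?thesis by (rule witness[of 1 6 2 5 3 4]) (unfold 17 defs set_eq_subset, simp_all)
  next
    case 18
    show ?thesis by (rule witness[of 1 3 2 4 6 5]) (unfold 18 defs set_eq_subset, simp_all)
  next
    case 19
    show ?thesis by (rule witness[of 1 2 3 6 4 5]) (unfold 19 defs set_eq_subset, simp_all)
  next
    case 20
    show ?thesis by (rule witness[of 1 5 2 3 4 6]) (unfold 20 defs set_eq_subset, simp_all)
  next
    case 21
    show ?thesis by (rule witness[of 1 3 2 5 6 4]) (unfold 21 defs set_eq_subset, simp_all)
  next
    case 22
    show ?thesis by (rule witness[of 1 4 2 3 5 6]) (unfold 22 defs set_eq_subset, simp_all)
  next
    case 23
    show ?thesis by (rule witness[of 1 5 2 6 4 3]) (unfold 23 defs set_eq_subset, simp_all)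
  next
    case 24
    show ?thesis by (rule witness[of 1 2 3 6 5 4]) (unfold 24 defs set_eq_subset, simp_all)
  next
    case 25
    show ?thesis by (rule witness[of 1 6 2 4 3 5]) (unfold 25 defs set_eq_subset, simp_all)
  next
    case 26
    show ?thesis by (rule witness[of 1 2 3 4 6 5]) (unfold 26 defs set_eq_subset, simp_all)
  next
    case 27
    show ?thesis by (rule witness[of 1 3 2 6 4 5]) (unfold 27 defs set_eq_subset, simp_all)
  next
    case 28
    show ?thesis by (rule witness[of 1 4 2 5 3 6]) (unfold 28 defs set_eq_subset, simp_all)
  next
    case 29
    show ?thesis by (rule witness[of 1 5 2 3 6 4]) (unfold 29 defs set_eq_subset, simp_all)
  next
    case 30
    show ?thesis by (rule witness[of 1 6 2 4 5 3]) (unfold 30 defs set_eq_subset, simp_all)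
  qed
qed

lemma inj_on_corner_numbers: "inj_on corner_numbers cubes"
proof (rule inj_onI)
  fix C D assume "C \<in> cubes" "D \<in> cubes" and eq: "corner_numbers C = corner_numbers D"
  have D: "n \<in> corner_numbers C \<Longrightarrow> n \<in> corner_numbers D" for n using eq by simp
  from \<open>C \<in> cubes\<close> show "C = D"
  proof (cases rule: cubes_cases)
    case 1
    from \<open>D \<in> cubes\<close> show ?thesis by (cases rule: cubes_cases) (use 1 D[of 126] D[of 143] in simp_all)
  next
    case 2
    from \<open>D \<in> cubes\<close> show ?thesis by (cases rule: cubes_cases) (use 2 D[of 125] D[of 134] in simp_all)
  next
    case 3
    from \<open>D \<in> cubes\<close> show ?thesis by (cases rule: cubes_cases) (use 3 D[of 123] D[of 165] in simp_all)
  next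
    case 4
    from \<open>D \<in> cubes\<close> show ?thesis by (cases rule: cubes_cases) (use 4 D[of 124] D[of 156] in simp_all)
  next
    case 5
    from \<open>D \<in> cubes\<close> show ?thesis by (cases rule: cubes_cases) (use 5 D[of 135] D[of 146] in simp_all)
  next
    case 6
    from \<open>D \<in> cubes\<close> show ?thesis by (cases rule: cubes_cases) (use 6 D[of 123] D[of 146] in simp_all)
  next
    case 7
    from \<open>D \<in> cubes\<close> show ?thesis by (cases rule: cubes_cases) (use 7 D[of 136] D[of 154] in simp_all)
  next
    case 8
    from \<open>D \<in> cubes\<close> show ?thesis by (cases rule: cubes_cases) (use 8 D[of 124] D[of 153] in simp_all)
  next
    case 9
    from \<open>D \<in> cubes\<close> show ?thesis by (cases rule: cubes_cases) (use 9 D[of 126] D[of 135] in simp_all)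
  next
    case 10
    from \<open>D \<in> cubes\<close> show ?thesis by (cases rule: cubes_cases) (use 10 D[of 125] D[of 164] in simp_all)
  next
    case 11
    from \<open>D \<in> cubes\<close> show ?thesis by (cases rule: cubes_cases) (use 11 D[of 124] D[of 135] in simp_all)
  next
    case 12
    from \<open>D \<in> cubes\<close> show ?thesis by (cases rule: cubes_cases) (use 12 D[of 134] D[of 156] in simp_all)
  next
    case 13
    from \<open>D \<in> cubes\<close> show ?thesis by (cases rule: cubes_cases) (use 13 D[of 125] D[of 146] in simp_all)
  next
    case 14
    from \<open>D \<in> cubes\<close> show ?thesis by (cases rule: cubes_cases) (use 14 D[of 123] D[of 164] in simp_all)
  next
    case 15
    from \<open>D \<in> cubes\<close> show ?thesis by (cases rule: cubes_cases) (use 15 D[of 126] D[of 153] in simp_all)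
  next
    case 16
    from \<open>D \<in> cubes\<close> show ?thesis by (cases rule: cubes_cases) (use 16 D[of 125] D[of 163] in simp_all)
  next
    case 17
    from \<open>D \<in> cubes\<close> show ?thesis by (cases rule: cubes_cases) (use 17 D[of 123] D[of 154] in simp_all)
  next
    case 18
    from \<open>D \<in> cubes\<close> show ?thesis by (cases rule: cubes_cases) (use 18 D[of 126] D[of 145] in simp_all)
  next
    case 19
    from \<open>D \<in> cubes\<close> show ?thesis by (cases rule: cubes_cases) (use 19 D[of 134] D[of 165] in simp_all)
  next
    case 20
    from \<open>D \<in> cubes\<close> show ?thesis by (cases rule: cubes_cases) (use 20 D[of 124] D[of 136] in simp_all)
  next
    case 21
    from \<open>D \<in> cubes\<close> show ?thesis by (cases rule: cubes_cases) (use 21 D[of 126] D[of 154] in simp_all)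
  next
    case 22
    from \<open>D \<in> cubes\<close> show ?thesis by (cases rule: cubes_cases) (use 22 D[of 125] D[of 136] in simp_all)
  next
    case 23
    from \<open>D \<in> cubes\<close> show ?thesis by (cases rule: cubes_cases) (use 23 D[of 124] D[of 163] in simp_all)
  next
    case 24
    from \<open>D \<in> cubes\<close> show ?thesis by (cases rule: cubes_cases) (use 24 D[of 135] D[of 164] in simp_all)
  next
    case 25
    from \<open>D \<in> cubes\<close> show ?thesis by (cases rule: cubes_cases) (use 25 D[of 123] D[of 145] in simp_all)
  next
    case 26
    from \<open>D \<in> cubes\<close> show ?thesis by (cases rule: cubes_cases) (use 26 D[of 136] D[of 145] in simp_all)
  next
    case 27
    from \<open>D \<in> cubes\<close> show ?thesis by (cases rule: cubes_cases) (use 27 D[of 124] D[of 165] in simp_all)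
  next
    case 28
    from \<open>D \<in> cubes\<close> show ?thesis by (cases rule: cubes_cases) (use 28 D[of 123] D[of 156] in simp_all)
  next
    case 29
    from \<open>D \<in> cubes\<close> show ?thesis by (cases rule: cubes_cases) (use 29 D[of 126] D[of 134] in simp_all)
  next
    case 30
    from \<open>D \<in> cubes\<close> show ?thesis by (cases rule: cubes_cases) (use 30 D[of 125] D[of 143] in simp_all)
  qed
qed

text \<open>Extensional functions are used so that each bijection on \<open>W\<close> is counted once.\<close>

definition solutions :: "position \<Rightarrow> position set \<Rightarrow> (position \<Rightarrow> nat) set" where
  "solutions T W = {\<sigma> \<in> extensional W.
     bij_betw \<sigma> W (corner_numbers T) \<and> (\<forall>C\<in>W. \<sigma> C \<in> corner_numbers C)}"

definition solution_number :: "position \<Rightarrow> position set \<Rightarrow> nat" where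
  "solution_number T W = card (solutions T W)"

text \<open>In the following, \<open>R\<close> is the set of selected rows and \<open>K\<close> the set of selected columns.\<close>

definition unselected :: "letter set \<Rightarrow> letter set \<Rightarrow> position set" where
  "unselected R K = {(X, y). X \<notin> R \<and> y \<notin> K}"

definition targets :: "letter set \<Rightarrow> letter set \<Rightarrow> position set" where
  "targets R K = unselected R K \<inter> cubes"

definition crossing_cubes :: "letter set \<Rightarrow> letter set \<Rightarrow> position set" where
  "crossing_cubes R K = (R \<times> K) \<inter> cubes"

definition work_set :: "letter set \<Rightarrow> letter set \<Rightarrow> position set" where
  "work_set R K = crossing_cubes R K - mirror ` targets R K"

end

theory Submission
  imports Defs "HOL-Combinatorics.Permutations"
begin

text \<open>The symmetric group of the six colours acts on the thirty cubes, and in terms of their names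
  it acts as the full symmetric group of the six letters, through the outer automorphism of
  \<open>S\<^sub>6\<close>: the transposition of the letters \<open>X\<close> and \<open>y\<close> is realised by exchanging the colours
  on opposite faces of the cube \<open>Xy\<close>. Reflecting the cubes interchanges rows and columns. Both kinds
  of symmetry carry solutions to solutions, and together they act transitively on the admissible
  selections. So it suffices to exhibit solutions for the five targets of a single selection.\<close>

section \<open>Solutions under relabelling\<close>

lemma finite_corner_numbers: "finite (corner_numbers C)"
  by (cases C rule: corner_numbers.cases) simp_all

lemma card_corner_numbers: "C \<in> cubes \<Longrightarrow> card (corner_numbers C) = 8"
  by (erule cubes_cases) simp_all

text \<open>Any bijection with the corner property becomes extensional by restriction to
  \<open>W\<close>, so positivity is plain existence. Finiteness of \<open>solutions T W\<close>
  matters here because \<open>card\<close> of an infinite set is 0.\<close>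

lemma solution_number_pos_iff:
  assumes "finite W"
  shows "solution_number T W > 0 \<longleftrightarrow>
    (\<exists>\<sigma>. bij_betw \<sigma> W (corner_numbers T) \<and> (\<forall>C\<in>W. \<sigma> C \<in> corner_numbers C))"
proof -
  have "solutions T W \<subseteq> W \<rightarrow>\<^sub>E corner_numbers T"
    by (auto simp: solutions_def PiE_def dest: bij_betwE)
  then have "finite (solutions T W)"
    by (rule finite_subset) (intro finite_PiE assms finite_corner_numbers)
  then have "solution_number T W > 0 \<longleftrightarrow> (\<exists>\<sigma>. \<sigma> \<in> solutions T W)"
    by (auto simp: solution_number_def card_gt_0_iff)
  also have "\<dots> \<longleftrightarrow> (\<exists>\<sigma>. bij_betw \<sigma> W (corner_numbers T) \<and> (\<forall>C\<in>W. \<sigma> C \<in> corner_numbers C))"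
  proof
    assume "\<exists>\<sigma>. bij_betw \<sigma> W (corner_numbers T) \<and> (\<forall>C\<in>W. \<sigma> C \<in> corner_numbers C)"
    then obtain \<sigma> where "bij_betw \<sigma> W (corner_numbers T)" "\<forall>C\<in>W. \<sigma> C \<in> corner_numbers C"
      by blast
    moreover from this(1) have "bij_betw (restrict \<sigma> W) W (corner_numbers T)"
      by (subst bij_betw_cong[where g = \<sigma>]) simp_all
    ultimately have "restrict \<sigma> W \<in> solutions T W"
      by (simp add: solutions_def)
    then show "\<exists>\<sigma>. \<sigma> \<in> solutions T W" by blast
  qed (auto simp: solutions_def)
  finally show ?thesis .
qed

text \<open>A single map \<open>g\<close> on corner numbers must serve all positions at once: a
  solution involves the corners of the target and of every cube in \<open>W\<close>.\<close>

definition corner_relabelling :: "(position \<Rightarrow> position) \<Rightarrow> bool" where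
  "corner_relabelling p \<longleftrightarrow> (\<exists>g. \<forall>C. corner_numbers (p C) = g ` corner_numbers C)"

lemma corner_relabelling_id: "corner_relabelling id"
  unfolding corner_relabelling_def by (rule exI[of _ id]) simp

lemma corner_relabelling_comp:
  assumes "corner_relabelling p" "corner_relabelling q"
  shows "corner_relabelling (p \<circ> q)"
proof -
  obtain g h where "corner_numbers (p C) = g ` corner_numbers C"
    and "corner_numbers (q C) = h ` corner_numbers C" for C
    using assms unfolding corner_relabelling_def by blast
  then have "corner_numbers ((p \<circ> q) C) = (g \<circ> h) ` corner_numbers C" for C
    by (simp add: image_comp)
  then show ?thesis unfolding corner_relabelling_def by blast
qed

text \<open>A solution \<open>\<sigma>\<close> is carried to
  \<open>g \<circ> \<sigma> \<circ> inv p\<close>: go back to the original cube, place it there,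
  then relabel its corner.\<close>

lemma solution_number_pos_relabel:
  assumes p: "corner_relabelling p" "inj p" and W: "finite W"
    and T: "T \<in> cubes" "p T \<in> cubes" and pos: "solution_number T W > 0"
  shows "solution_number (p T) (p ` W) > 0"
proof -
  obtain g where g: "corner_numbers (p C) = g ` corner_numbers C" for C
    using p unfolding corner_relabelling_def by blast
  obtain \<sigma> where \<sigma>: "bij_betw \<sigma> W (corner_numbers T)" "\<forall>C\<in>W. \<sigma> C \<in> corner_numbers C"
    using pos W by (auto simp: solution_number_pos_iff)
  \<comment> \<open>\<open>g\<close> maps the 8 corners of \<open>T\<close> onto the 8 corners of
    \<open>p T\<close>, so it is injective on them.\<close>
  have "inj_on g (corner_numbers T)"
    by (rule eq_card_imp_inj_on)
      (use T in \<open>simp_all add: finite_corner_numbers card_corner_numbers flip: g\<close>)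
  then have "bij_betw g (corner_numbers T) (corner_numbers (p T))"
    by (simp add: bij_betw_def g)
  moreover have "bij_betw (inv p) (p ` W) W"
    using p(2) by (intro bij_betw_byWitness[where f' = p]) auto
  ultimately have "bij_betw (g \<circ> \<sigma> \<circ> inv p) (p ` W) (corner_numbers (p T))"
    using \<sigma>(1) by (blast intro: bij_betw_trans)
  moreover have "\<forall>C\<in>p ` W. (g \<circ> \<sigma> \<circ> inv p) C \<in> corner_numbers C"
    using \<sigma>(2) p(2) by (auto simp: g)
  ultimately show ?thesis
    using W by (subst solution_number_pos_iff) blast+
qed

section \<open>Symmetries of the tableau\<close>

text \<open>The list \<open>s\<close> holds the new colours. Colours start at 1, so its entry at index 0 is unused.\<close>

definition recolour :: "nat list \<Rightarrow> nat \<Rightarrow> nat" where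
  "recolour s n = corner_number (s ! (n div 100)) (s ! (n div 10 mod 10)) (s ! (n mod 10))"

text \<open>A reflection turns clockwise into anticlockwise, so the digits are read backwards and
  the least rotation is taken again.\<close>

definition reflect_corner :: "nat \<Rightarrow> nat" where
  "reflect_corner n = corner_number (n mod 10) (n div 10 mod 10) (n div 100)"

lemma corner_numbers_diagonal: "corner_numbers (X, X) = {}"
  by (cases X) simp_all

lemma corner_relabelling_mirror: "corner_relabelling mirror"
proof -
  have "corner_numbers (mirror C) = reflect_corner ` corner_numbers C" for C
  proof (cases "C \<in> cubes")
    case True
    then show ?thesis
      by (rule cubes_cases)
        (simp_all only: mirror_def prod.case corner_numbers.simps image_insert image_empty,
          simp_all add: reflect_corner_def corner_number_def set_eq_subset)
  next
    case False
    then show ?thesis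
      by (auto simp: cubes_def mirror_def corner_numbers_diagonal)
  qed
  then show ?thesis unfolding corner_relabelling_def by blast
qed

text \<open>Diagonal positions go to diagonal positions, and all of these have the empty corner set,
  so checking the thirty cubes suffices.\<close>

lemma corner_relabelling_letter_recolour:
  assumes "\<And>C. C \<in> cubes \<Longrightarrow> corner_numbers (map_prod f f C) = recolour s ` corner_numbers C"
  shows "corner_relabelling (map_prod f f)"
proof -
  have "corner_numbers (map_prod f f C) = recolour s ` corner_numbers C" for C
    using assms by (cases "C \<in> cubes") (auto simp: cubes_def corner_numbers_diagonal)
  then show ?thesis unfolding corner_relabelling_def by blast
qed

text \<open>In each case the list exchanges the colours on opposite faces of the cube named by the two
  transposed letters.\<close>

lemma corner_relabelling_transpose_ordered:
  "corner_relabelling (map_prod (transpose LA LB) (transpose LA LB))"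
  "corner_relabelling (map_prod (transpose LA LC) (transpose LA LC))"
  "corner_relabelling (map_prod (transpose LA LD) (transpose LA LD))"
  "corner_relabelling (map_prod (transpose LA LE) (transpose LA LE))"
  "corner_relabelling (map_prod (transpose LA LF) (transpose LA LF))"
  "corner_relabelling (map_prod (transpose LB LC) (transpose LB LC))"
  "corner_relabelling (map_prod (transpose LB LD) (transpose LB LD))"
  "corner_relabelling (map_prod (transpose LB LE) (transpose LB LE))"
  "corner_relabelling (map_prod (transpose LB LF) (transpose LB LF))"
  "corner_relabelling (map_prod (transpose LC LD) (transpose LC LD))"
  "corner_relabelling (map_prod (transpose LC LE) (transpose LC LE))"
  "corner_relabelling (map_prod (transpose LC LF) (transpose LC LF))"
  "corner_relabelling (map_prod (transpose LD LE) (transpose LD LE))"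
  "corner_relabelling (map_prod (transpose LD LF) (transpose LD LF))"
  "corner_relabelling (map_prod (transpose LE LF) (transpose LE LF))"
proof -
  note letters = map_prod_simp transpose_def letter.distinct simp_thms if_True if_False
    corner_numbers.simps image_insert image_empty
  note colours = recolour_def corner_number_def set_eq_subset
  show "corner_relabelling (map_prod (transpose LA LB) (transpose LA LB))"
    by (rule corner_relabelling_letter_recolour[where s = "[0, 5, 4, 6, 2, 1, 3]"], erule cubes_cases)
      (simp_all only: letters, simp_all add: colours)
  show "corner_relabelling (map_prod (transpose LA LC) (transpose LA LC))"
    by (rule corner_relabelling_letter_recolour[where s = "[0, 6, 3, 2, 5, 4, 1]"], erule cubes_cases)
      (simp_all only: letters, simp_all add: colours)
  show "corner_relabelling (map_prod (transpose LA LD) (transpose LA LD))"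
    by (rule corner_relabelling_letter_recolour[where s = "[0, 4, 6, 5, 1, 3, 2]"], erule cubes_cases)
      (simp_all only: letters, simp_all add: colours)
  show "corner_relabelling (map_prod (transpose LA LE) (transpose LA LE))"
    by (rule corner_relabelling_letter_recolour[where s = "[0, 3, 5, 1, 6, 2, 4]"], erule cubes_cases)
      (simp_all only: letters, simp_all add: colours)
  show "corner_relabelling (map_prod (transpose LA LF) (transpose LA LF))"
    by (rule corner_relabelling_letter_recolour[where s = "[0, 2, 1, 4, 3, 6, 5]"], erule cubes_cases)
      (simp_all only: letters, simp_all add: colours)
  show "corner_relabelling (map_prod (transpose LB LC) (transpose LB LC))"
    by (rule corner_relabelling_letter_recolour[where s = "[0, 2, 1, 5, 6, 3, 4]"], erule cubes_cases)
      (simp_all only: letters, simp_all add: colours)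
  show "corner_relabelling (map_prod (transpose LB LD) (transpose LB LD))"
    by (rule corner_relabelling_letter_recolour[where s = "[0, 6, 5, 4, 3, 2, 1]"], erule cubes_cases)
      (simp_all only: letters, simp_all add: colours)
  show "corner_relabelling (map_prod (transpose LB LE) (transpose LB LE))"
    by (rule corner_relabelling_letter_recolour[where s = "[0, 4, 3, 2, 1, 6, 5]"], erule cubes_cases)
      (simp_all only: letters, simp_all add: colours)
  show "corner_relabelling (map_prod (transpose LB LF) (transpose LB LF))"
    by (rule corner_relabelling_letter_recolour[where s = "[0, 3, 6, 1, 5, 4, 2]"], erule cubes_cases)
      (simp_all only: letters, simp_all add: colours)
  show "corner_relabelling (map_prod (transpose LC LD) (transpose LC LD))"
    by (rule corner_relabelling_letter_recolour[where s = "[0, 3, 4, 1, 2, 6, 5]"], erule cubes_cases)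
      (simp_all only: letters, simp_all add: colours)
  show "corner_relabelling (map_prod (transpose LC LE) (transpose LC LE))"
    by (rule corner_relabelling_letter_recolour[where s = "[0, 5, 6, 4, 3, 1, 2]"], erule cubes_cases)
      (simp_all only: letters, simp_all add: colours)
  show "corner_relabelling (map_prod (transpose LC LF) (transpose LC LF))"
    by (rule corner_relabelling_letter_recolour[where s = "[0, 4, 5, 6, 1, 2, 3]"], erule cubes_cases)
      (simp_all only: letters, simp_all add: colours)
  show "corner_relabelling (map_prod (transpose LD LE) (transpose LD LE))"
    by (rule corner_relabelling_letter_recolour[where s = "[0, 2, 1, 6, 5, 4, 3]"], erule cubes_cases)
      (simp_all only: letters, simp_all add: colours)
  show "corner_relabelling (map_prod (transpose LD LF) (transpose LD LF))"
    by (rule corner_relabelling_letter_recolour[where s = "[0, 5, 3, 2, 6, 1, 4]"], erule cubes_cases)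
      (simp_all only: letters, simp_all add: colours)
  show "corner_relabelling (map_prod (transpose LE LF) (transpose LE LF))"
    by (rule corner_relabelling_letter_recolour[where s = "[0, 6, 4, 5, 2, 3, 1]"], erule cubes_cases)
      (simp_all only: letters, simp_all add: colours)
qed

lemma corner_relabelling_transpose:
  assumes "X \<noteq> y"
  shows "corner_relabelling (map_prod (transpose X y) (transpose X y))"
proof -
  \<comment> \<open>One of the two orders of the pair is among the fifteen computed cases.\<close>
  have "corner_relabelling (map_prod (transpose X y) (transpose X y)) \<or>
      corner_relabelling (map_prod (transpose y X) (transpose y X))"
    using assms by (cases X; cases y) (simp_all add: corner_relabelling_transpose_ordered)
  then show ?thesis by (simp add: transpose_commute[of y X])
qed

instance letter :: finite
proof
  have "UNIV = {LA, LB, LC, LD, LE, LF}"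
    by (auto intro: letter.exhaust)
  then show "finite (UNIV :: letter set)"
    by (metis finite.emptyI finite.insertI)
qed

text \<open>Transpositions generate the symmetric group, and relabellings are closed under
  composition.\<close>

lemma corner_relabelling_letters:
  assumes "bij f"
  shows "corner_relabelling (map_prod f f)"
proof -
  have "f permutes UNIV"
    using assms by (rule bij_imp_permutes) simp
  moreover have "finite (UNIV :: letter set)" by simp
  ultimately show ?thesis
  proof (induction rule: permutes_induct)
    case id
    show ?case using corner_relabelling_id by (simp only: map_prod.id)
  next
    case (swap a b f)
    then have "corner_relabelling (map_prod (transpose a b) (transpose a b) \<circ> map_prod f f)"
      by (intro corner_relabelling_comp corner_relabelling_transpose)
    then show ?case by (simp only: map_prod.comp)
  qed
qed

section \<open>Selections of rows and columns\<close>

text \<open>The full conclusion for one selection, bundled so that a symmetry transports all its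
  clauses together.\<close>

definition good_selection :: "letter set \<Rightarrow> letter set \<Rightarrow> bool" where
  "good_selection R K \<longleftrightarrow>
     card (targets R K) = 5 \<and>
     card (unselected R K - cubes) = 1 \<and>
     card (crossing_cubes R K) = 10 \<and>
     card (crossing_cubes R K \<inter> mirror ` targets R K) = 2 \<and>
     card (work_set R K) = 8 \<and>
     (\<forall>T \<in> targets R K. solution_number T (work_set R K) > 0)"

text \<open>Every set in \<open>good_selection\<close> is built from the two blocks,
  \<open>cubes\<close> and \<open>mirror\<close> by operations that commute with the injection
  \<open>p\<close>, so each is the \<open>p\<close>-image of its counterpart and cardinalities
  agree. Speaking of blocks rather than of images of \<open>R\<close> and \<open>K\<close> also
  admits symmetries that exchange rows and columns.\<close>

lemma good_selection_relabel:
  assumes p: "corner_relabelling p" "inj p" "\<And>C. p (mirror C) = mirror (p C)"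
    and unselected: "unselected R' K' = p ` unselected R K"
    and crossing: "R' \<times> K' = p ` (R \<times> K)"
    and cubes: "p ` cubes = cubes"
    and good: "good_selection R K"
  shows "good_selection R' K'"
proof -
  have targets: "targets R' K' = p ` targets R K"
    using p(2) cubes unfolding targets_def unselected by (metis image_Int)
  have mirrors: "mirror ` targets R' K' = p ` mirror ` targets R K"
    by (simp add: targets image_image p(3))
  have crossing_cubes: "crossing_cubes R' K' = p ` crossing_cubes R K"
    using p(2) cubes unfolding crossing_cubes_def crossing by (metis image_Int)
  have diagonal: "unselected R' K' - cubes = p ` (unselected R K - cubes)"
    using p(2) cubes unfolding unselected by (metis image_set_diff)
  have both: "crossing_cubes R' K' \<inter> mirror ` targets R' K' =
      p ` (crossing_cubes R K \<inter> mirror ` targets R K)"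
    using p(2) by (simp add: crossing_cubes mirrors image_Int)
  have work: "work_set R' K' = p ` work_set R K"
    using p(2) by (simp add: work_set_def crossing_cubes mirrors image_set_diff)
  have card_p: "card (p ` S) = card S" for S
    using p(2) by (simp add: card_image inj_on_subset)
  have "solution_number (p T) (p ` work_set R K) > 0" if "T \<in> targets R K" for T
    using that p(1,2) cubes good
    by (intro solution_number_pos_relabel) (auto simp: good_selection_def targets_def)
  then show ?thesis
    using good unfolding good_selection_def both diagonal
    by (simp add: targets crossing_cubes work card_p)
qed

text \<open>\<open>mirror\<close> transposes the tableau; this yields the version with three rows
  and four columns.\<close>

lemma good_selection_swap:
  assumes "good_selection R K"
  shows "good_selection K R"
  by (rule good_selection_relabel[OF corner_relabelling_mirror _ _ _ _ _ assms])
    (auto simp: mirror_def inj_def unselected_def cubes_def image_iff)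

text \<open>Applying the same \<open>f\<close> to both coordinates keeps the diagonal in place and
  commutes with \<open>mirror\<close>.\<close>

lemma good_selection_letters:
  assumes "bij f" "good_selection R K"
  shows "good_selection (f ` R) (f ` K)"
proof (rule good_selection_relabel[OF corner_relabelling_letters[OF assms(1)] _ _ _ _ _ assms(2)])
  have inj: "inj f" and surj: "surj f"
    using assms(1) by (auto simp: bij_def)
  then have unselected_iff: "unselected (f ` R) (f ` K) = (f ` (- R)) \<times> (f ` (- K))"
    by (auto simp: unselected_def bij_image_Compl_eq[OF assms(1)])
  show "unselected (f ` R) (f ` K) = map_prod f f ` unselected R K"
    unfolding unselected_iff by (auto simp: unselected_def image_iff)
  show "map_prod f f ` cubes = cubes"
  proof (intro subset_antisym subsetI)
    fix C assume "C \<in> cubes"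
    moreover obtain X y where "C = (f X, f y)"
      using surj by (metis surj_def surj_pair)
    ultimately show "C \<in> map_prod f f ` cubes"
      by (auto simp: cubes_def intro!: rev_image_eqI[of "(X, y)"])
  qed (use inj in \<open>auto simp: cubes_def inj_eq\<close>)
qed (use assms(1) in \<open>auto simp: mirror_def prod.inj_map bij_def\<close>)

text \<open>The representative selection: \<open>LA\<close> and \<open>LB\<close> are chosen as row
  and column, \<open>LC\<close> only as column, \<open>LD\<close> and \<open>LE\<close> only as
  rows, and \<open>LF\<close> as neither.\<close>

lemma good_selection_base: "good_selection {LA, LB, LD, LE} {LA, LB, LC}"
proof -
  let ?R = "{LA, LB, LD, LE}" and ?K = "{LA, LB, LC}"
  let ?W = "{(LA, LB), (LA, LC), (LB, LA), (LB, LC), (LD, LA), (LD, LB), (LE, LA), (LE, LB)}"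
  have compl: "- ?R = {LC, LF}" "- ?K = {LD, LE, LF}"
    by (auto intro: letter.exhaust)
  have unselected_Times: "unselected ?R ?K = (- ?R) \<times> (- ?K)"
    by (auto simp: unselected_def)
  have unselected: "unselected ?R ?K =
      {(LC, LD), (LC, LE), (LC, LF), (LF, LD), (LF, LE), (LF, LF)}"
    unfolding unselected_Times compl by auto
  have targets: "targets ?R ?K = {(LC, LD), (LC, LE), (LC, LF), (LF, LD), (LF, LE)}"
    unfolding targets_def unselected by (auto simp: cubes_def)
  have diagonal: "unselected ?R ?K - cubes = {(LF, LF)}"
    unfolding unselected by (auto simp: cubes_def)
  have crossing: "crossing_cubes ?R ?K = insert (LD, LC) (insert (LE, LC) ?W)"
    by (auto simp: crossing_cubes_def cubes_def)
  \<comment> \<open>These are the mirrors of \<open>(LC, LD)\<close> and \<open>(LC, LE)\<close>.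
    The mirrors of the other three targets have row or column \<open>LF\<close>, which is not
    selected.\<close>
  have both: "crossing_cubes ?R ?K \<inter> mirror ` targets ?R ?K = {(LD, LC), (LE, LC)}"
    unfolding crossing targets by (auto simp: mirror_def)
  have work: "work_set ?R ?K = ?W"
    unfolding work_set_def crossing targets by (auto simp: mirror_def)
  \<comment> \<open>Both sides have 8 elements, so an assignment that hits every corner of
    \<open>T\<close> is automatically injective; only its image and the corner property remain to be
    computed.\<close>
  have solvable: "solution_number T ?W > 0"
    if "T \<in> cubes" and image: "\<sigma> ` ?W = corner_numbers T"
      and "\<forall>C\<in>?W. \<sigma> C \<in> corner_numbers C" for T \<sigma>
  proof -
    have "card (\<sigma> ` ?W) = card ?W"
      unfolding image using that(1) by (simp add: card_corner_numbers)
    then have "inj_on \<sigma> ?W"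
      by (rule eq_card_imp_inj_on[rotated]) simp
    with image have "bij_betw \<sigma> ?W (corner_numbers T)"
      by (simp only: bij_betw_def)
    with that(3) show ?thesis
      by (subst solution_number_pos_iff) (simp, blast)
  qed
  \<comment> \<open>Here and for the next four targets, an explicit solution gives each cube a
    corner it shares with the target. The default 0 is taken only outside \<open>?W\<close>.\<close>
  have CD: "solution_number (LC, LD) ?W > 0"
    by (rule solvable[where \<sigma> = "(\<lambda>_. 0)((LA, LB) := 235, (LA, LC) := 125, (LB, LA) := 146, (LB, LC) := 154,
        (LD, LA) := 364, (LD, LB) := 263, (LE, LA) := 345, (LE, LB) := 162)"])
      (simp_all add: cubes_def set_eq_subset)
  have CE: "solution_number (LC, LE) ?W > 0"
    by (rule solvable[where \<sigma> = "(\<lambda>_. 0)((LA, LB) := 164, (LA, LC) := 142, (LB, LA) := 253, (LB, LC) := 136,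
        (LD, LA) := 465, (LD, LB) := 123, (LE, LA) := 356, (LE, LB) := 245)"])
      (simp_all add: cubes_def set_eq_subset)
  have CF: "solution_number (LC, LF) ?W > 0"
    by (rule solvable[where \<sigma> = "(\<lambda>_. 0)((LA, LB) := 126, (LA, LC) := 153, (LB, LA) := 456, (LB, LC) := 234,
        (LD, LA) := 132, (LD, LB) := 246, (LE, LA) := 165, (LE, LB) := 354)"])
      (simp_all add: cubes_def set_eq_subset)
  have FD: "solution_number (LF, LD) ?W > 0"
    by (rule solvable[where \<sigma> = "(\<lambda>_. 0)((LA, LB) := 126, (LA, LC) := 134, (LB, LA) := 354, (LB, LC) := 256,
        (LD, LA) := 163, (LD, LB) := 365, (LE, LA) := 142, (LE, LB) := 245)"])
      (simp_all add: cubes_def set_eq_subset)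
  have FE: "solution_number (LF, LE) ?W > 0"
    by (rule solvable[where \<sigma> = "(\<lambda>_. 0)((LA, LB) := 132, (LA, LC) := 265, (LB, LA) := 456, (LB, LC) := 143,
        (LD, LA) := 125, (LD, LB) := 154, (LE, LA) := 236, (LE, LB) := 346)"])
      (simp_all add: cubes_def set_eq_subset)
  show ?thesis
    unfolding good_selection_def both unfolding targets diagonal work crossing
    by (simp add: CD CE CF FD FE)
qed

text \<open>The hypotheses fix the sizes of all four Venn regions of \<open>R\<close> and
  \<open>K\<close> as 2, 1, 2, 1, the same as in the representative, so some permutation of the
  letters matches the two selections.\<close>

lemma good_selection_three_columns:
  assumes "card K = 3" "card R = 4" "card (R \<inter> K) = 2" "card (R - K) = 2"
  shows "good_selection R K"
proof -
  have UNIV_letter: "UNIV = {LA, LB, LC, LD, LE, LF}"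
    by (auto intro: letter.exhaust)
  have "card (K - R) = 1"
    using assms by (simp add: card_Diff_subset_Int Int_commute)
  moreover have "card (- (R \<union> K)) = 1"
  proof -
    \<comment> \<open>The union has 4 + 3 - 2 = 5 of the 6 letters, leaving exactly one
      outside.\<close>
    have "card (R \<union> K) + card (R \<inter> K) = card R + card K"
      by (rule card_Un_Int[symmetric]) simp_all
    then show ?thesis
      using assms card_Diff_subset[of "R \<union> K" UNIV]
      by (simp add: Compl_eq_Diff_UNIV) (simp add: UNIV_letter)
  qed
  ultimately obtain a b c d e g where blocks: "R \<inter> K = {a, b}" "K - R = {c}" "R - K = {d, e}"
      "- (R \<union> K) = {g}"
    using assms(3,4) by (auto simp: card_2_iff card_1_singleton_iff)
  \<comment> \<open>\<open>f\<close> sends each region of the representative to the corresponding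
    region here. The regions cover all letters, so \<open>f\<close> is surjective, and hence
    bijective on a finite type.\<close>
  define f where "f = case_letter a b c d e g"
  have "range f = (R \<inter> K) \<union> (K - R) \<union> (R - K) \<union> - (R \<union> K)"
    unfolding blocks by (auto simp: f_def UNIV_letter)
  then have "surj f" by auto
  then have "bij f"
    by (simp add: bij_def finite_UNIV_surj_inj)
  moreover have "f ` {LA, LB, LD, LE} = (R \<inter> K) \<union> (R - K)" "f ` {LA, LB, LC} = (R \<inter> K) \<union> (K - R)"
    unfolding blocks by (auto simp: f_def)
  then have "f ` {LA, LB, LD, LE} = R" "f ` {LA, LB, LC} = K"
    by auto
  ultimately show ?thesis
    using good_selection_letters[OF _ good_selection_base] by metis
qed

theorem theorem15:
  fixes R K :: "letter set"
  assumes "(card K = 3 \<and> card R = 4 \<and> card (R \<inter> K) = 2 \<and> card (R - K) = 2) \<or>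
           (card R = 3 \<and> card K = 4 \<and> card (K \<inter> R) = 2 \<and> card (K - R) = 2)"
  shows "card (targets R K) = 5 \<and>
         card (unselected R K - cubes) = 1 \<and>
         card (crossing_cubes R K) = 10 \<and>
         card (crossing_cubes R K \<inter> mirror ` targets R K) = 2 \<and>
         card (work_set R K) = 8 \<and>
         (\<forall>T \<in> targets R K. solution_number T (work_set R K) > 0)"
  using assms good_selection_three_columns good_selection_swap
  unfolding good_selection_def[symmetric] by blast

end
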